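(* Let $n,k,s,t,i$ be positive integers with $t\ge 3$, $(t+1)(k-t+1)\le n$, $t+3\le s\le 2k-t$ and $\max\{t+1,\,s+t-k\}\le i\le \min\{k,\frac{s+t}{2}\}$, and suppose $(s,i,t)\ne(6,4,3)$. Define \[ S_1=s(n-s+1)-i(k-i),\qquad S_2=s(n-s+1)-(s+t-i)(k+i-s-t), \] \[ T_1=i(n-k-s+i+1)+(s-i)(k-i+1),\qquad T_2=(s+t-i)(n-k-i+t+1)+(i-t)(k-s-t+i+1). \] Then \[ \frac{(k-i+1)(k+i+1-s-t)S_1S_2}{(n-s+1)^2T_1T_2}>\frac{\binom{n-s}{k-i}\binom{n-s}{k+i-s-t}}{\binom{n-s}{k-i+1}\binom{n-s}{k+i+1-s-t}}. \] *)

theory Defs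
  imports Complex_Main
begin

end

theory Submission
  imports Defs "HOL-Decision_Procs.Commutative_Ring"
begin

text \<open>
  Put \<open>j = s + t - i\<close>, \<open>a = k - i\<close>, \<open>b = k - j\<close> and \<open>M = n - s + 1\<close>. Evaluating the ratios of
  consecutive binomial coefficients turns the claim into the polynomial inequality
  \<open>M\<^sup>2 T\<^sub>1 T\<^sub>2 < (M - 1 - a) (M - 1 - b) S\<^sub>1 S\<^sub>2\<close>, in which \<open>(i, a, S\<^sub>1, T\<^sub>1)\<close> and
  \<open>(j, b, S\<^sub>2, T\<^sub>2)\<close> play symmetric roles. Express the variables by the slacks of the hypotheses:
  \<open>t = 3 + u\<close>, \<open>i = t + 1 + p\<close>, \<open>j = i + q\<close>, \<open>k = j + b\<close> and
  \<open>M = (t + 1) (k - t + 1) - s + 1 + m\<close>. The hypotheses leave three cases, namely \<open>p \<ge> 1\<close>;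
  \<open>p = 0\<close>, \<open>u \<ge> 1\<close>, \<open>q \<ge> 1\<close>; and \<open>p = u = 0\<close>, \<open>q \<ge> 2\<close>. After shifting the variables to start
  at 0 in each of them, the difference of the two sides is a polynomial with nonnegative
  coefficients and positive constant term.
\<close>

primrec nonneg_coeffs :: "pol \<Rightarrow> bool" where
  "nonneg_coeffs (Pc c) \<longleftrightarrow> 0 \<le> c"
| "nonneg_coeffs (Pinj i P) \<longleftrightarrow> nonneg_coeffs P"
| "nonneg_coeffs (PX P i Q) \<longleftrightarrow> nonneg_coeffs P \<and> nonneg_coeffs Q"

lemma head_nonneg:
  fixes xs :: "'a::linordered_idom list"
  shows "\<forall>x\<in>set xs. 0 \<le> x \<Longrightarrow> 0 \<le> cring_class.head xs"
  by (cases xs) simp_all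

text \<open>\<open>PX P i Q\<close> is the Horner form \<open>P * x ^ i + Q\<close> with
  \<open>x\<close> the head of \<open>xs\<close> and \<open>Q\<close> evaluated on the tail, so
  nonnegativity passes up the constructors.\<close>

lemma Ipol_nonneg:
  fixes xs :: "'a::linordered_idom list"
  assumes "nonneg_coeffs P" "\<forall>x\<in>set xs. 0 \<le> x"
  shows "0 \<le> cring_class.Ipol xs P"
  using assms
proof (induction P arbitrary: xs)
  case (Pinj i P)
  then show ?case by (auto dest: in_set_dropD)
next
  case (PX P i Q)
  have "\<forall>x\<in>set (drop 1 xs). 0 \<le> x"
    using PX.prems(2) by (auto dest: in_set_dropD)
  with PX show ?case
    by (simp add: head_nonneg)
qed simp

text \<open>Subtracting \<open>Const 1\<close> encodes strictness: coefficients are integers, so a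
  positive constant term stays nonnegative.\<close>

lemma Ipolex_pos:
  fixes xs :: "'a::linordered_idom list"
  assumes "nonneg_coeffs (Commutative_Ring.norm (Sub e (Const 1)))" "\<forall>x\<in>set xs. 0 \<le> x"
  shows "0 < cring_class.Ipolex xs e"
proof -
  have xs: "cring_class.in_carrier xs"
    by (simp add: cring_class.in_carrier_def carrier_class)
  have "0 \<le> cring_class.Ipolex xs (Sub e (Const 1))"
    unfolding cring_class.norm_ci[OF xs] by (rule Ipol_nonneg[OF assms])
  then show ?thesis by simp
qed

text \<open>Right side minus left side of the polynomial inequality, with \<open>k\<close>
  eliminated through \<open>k = j + b\<close>.\<close>

definition gap :: "'a::comm_ring_1 \<Rightarrow> 'a \<Rightarrow> 'a \<Rightarrow> 'a \<Rightarrow> 'a \<Rightarrow> 'a" where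
  "gap t i j b M =
    (let s = i + j - t; a = j + b - i in
      ((M - 1 - a) * (s * M - i * a)) * ((M - 1 - b) * (s * M - j * b))
      - (M * (i * (M - a) + (s - i) * (a + 1))) * (M * (j * (M - b) + (s - j) * (b + 1))))"

text \<open>A syntactic copy of \<open>gap\<close>, since normalisation acts on \<open>polex\<close>
  terms. The arguments are expressions, so that slacks can be substituted first.\<close>

definition gap_polex :: "polex \<Rightarrow> polex \<Rightarrow> polex \<Rightarrow> polex \<Rightarrow> polex \<Rightarrow> polex" where
  "gap_polex t i j b M =
    (let s = Sub (Add i j) t; a = Sub (Add j b) i in
      Sub (Mul (Mul (Sub (Sub M (Const 1)) a) (Sub (Mul s M) (Mul i a)))
               (Mul (Sub (Sub M (Const 1)) b) (Sub (Mul s M) (Mul j b))))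
          (Mul (Mul M (Add (Mul i (Sub M a)) (Mul (Sub s i) (Add a (Const 1)))))
               (Mul M (Add (Mul j (Sub M b)) (Mul (Sub s j) (Add b (Const 1)))))))"

definition slack_gap_polex :: "polex \<Rightarrow> polex \<Rightarrow> polex \<Rightarrow> polex \<Rightarrow> polex \<Rightarrow> polex" where
  "slack_gap_polex u p q b m =
    (let t = Add u (Const 3); i = Add t (Add p (Const 1)); j = Add i q in
      gap_polex t i j b
        (Add (Sub (Mul (Add t (Const 1)) (Add (Sub (Add j b) t) (Const 1)))
                  (Sub (Sub (Add i j) t) (Const 1))) m))"

text \<open>One computed certificate per case. \<open>Var 0\<close> to \<open>Var 4\<close> stand
  for \<open>q\<close>, \<open>b\<close>, \<open>m\<close>, \<open>u\<close>, \<open>p\<close>, up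
  to the shift made in the case.\<close>

lemma slack_gap_polex_nonneg_coeffs:
  "nonneg_coeffs (Commutative_Ring.norm (Sub
    (slack_gap_polex (Var 3) (Add (Var 4) (Const 1)) (Var 0) (Var 1) (Var 2)) (Const 1)))"
  "nonneg_coeffs (Commutative_Ring.norm (Sub
    (slack_gap_polex (Add (Var 3) (Const 1)) (Const 0) (Add (Var 0) (Const 1)) (Var 1) (Var 2))
    (Const 1)))"
  "nonneg_coeffs (Commutative_Ring.norm (Sub
    (slack_gap_polex (Const 0) (Const 0) (Add (Var 0) (Const 2)) (Var 1) (Var 2)) (Const 1)))"
  by code_simp+

lemma gap_pos_from_slacks:
  fixes t i j b M :: "'a::linordered_idom"
  assumes "nonneg_coeffs (Commutative_Ring.norm (Sub (slack_gap_polex u p q c m) (Const 1)))"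
    and "\<forall>x\<in>set xs. 0 \<le> x"
    and "cring_class.Ipolex xs u = t - 3"
    and "cring_class.Ipolex xs p = i - t - 1"
    and "cring_class.Ipolex xs q = j - i"
    and "cring_class.Ipolex xs c = b"
    and "cring_class.Ipolex xs m = M - ((t + 1) * (j + b - t + 1) - (i + j - t - 1))"
  shows "0 < gap t i j b M"
proof -
  have "cring_class.Ipolex xs (slack_gap_polex u p q c m) = gap t i j b M"
    by (simp add: slack_gap_polex_def gap_polex_def gap_def Let_def assms(3-7))
  with Ipolex_pos[OF assms(1,2)] show ?thesis by simp
qed

lemma gap_pos:
  fixes t i j b M :: real
  assumes "3 \<le> t" "t + 1 \<le> i" "i \<le> j" "0 \<le> b"
    and M: "(t + 1) * (j + b - t + 1) - (i + j - t - 1) \<le> M"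
    and "t + 2 \<le> i \<or> i = t + 1 \<and> 4 \<le> t \<and> i + 1 \<le> j \<or> i = t + 1 \<and> t = 3 \<and> i + 2 \<le> j"
  shows "0 < gap t i j b M"
proof -
  define m where "m = M - ((t + 1) * (j + b - t + 1) - (i + j - t - 1))"
  have "0 \<le> m" using M by (simp add: m_def)
  consider "t + 2 \<le> i" | "i = t + 1" "4 \<le> t" "i + 1 \<le> j" | "i = t + 1" "t = 3" "i + 2 \<le> j"
    using assms(6) by blast
  then show ?thesis
  proof cases
    case 1
    \<comment> \<open>The last entry is the slack \<open>i - t - 1\<close> lowered by 1, matching
      the shifted \<open>p\<close> of the certificate.\<close>
    show ?thesis
      by (rule gap_pos_from_slacks[OF slack_gap_polex_nonneg_coeffs(1),
            where xs = "[j - i, b, m, t - 3, i - t - 2]"])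
        (use 1 assms \<open>0 \<le> m\<close> in \<open>simp_all add: numeral_eq_Suc m_def\<close>)
  next
    case 2
    show ?thesis
      by (rule gap_pos_from_slacks[OF slack_gap_polex_nonneg_coeffs(2),
            where xs = "[j - i - 1, b, m, t - 4]"])
        (use 2 assms \<open>0 \<le> m\<close> in \<open>simp_all add: m_def\<close>)
  next
    case 3
    show ?thesis
      by (rule gap_pos_from_slacks[OF slack_gap_polex_nonneg_coeffs(3),
            where xs = "[j - i - 2, b, m]"])
        (use 3 assms \<open>0 \<le> m\<close> in \<open>simp_all add: m_def\<close>)
  qed
qed

text \<open>By absorption, both sides of the first identity equal
  \<open>N * ((N - 1) choose a)\<close>. The bound on \<open>a\<close> keeps the denominators
  nonzero.\<close>

lemma binomial_ratio:
  assumes "a < N"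
  shows "real (N choose a) / real (N choose Suc a) = (real a + 1) / (real N - real a)"
proof -
  have "Suc a * (N choose Suc a) = (N - a) * (N choose a)"
    by (simp only: binomial_absorption binomial_absorb_comp)
  then have "real (Suc a) * real (N choose Suc a) = real (N - a) * real (N choose a)"
    by (metis of_nat_mult)
  moreover have "real (N choose Suc a) \<noteq> 0" "real N - real a \<noteq> 0"
    using assms by auto
  ultimately show ?thesis
    using assms by (simp add: field_simps of_nat_diff)
qed

theorem theorem3p2:
  fixes n k s t i :: nat
    and S1 S2 T1 T2 :: real
  assumes "n > 0" and "k > 0" and "s > 0" and "t > 0" and "i > 0"
    and "t \<ge> 3"
    and "(real t + 1) * (real k - real t + 1) \<le> real n"
    and "real t + 3 \<le> real s" and "real s \<le> 2 * real k - real t"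
    and "max (real t + 1) (real s + real t - real k) \<le> real i"
    and "real i \<le> min (real k) ((real s + real t) / 2)"
    and "(s, i, t) \<noteq> (6, 4, 3)"
    and "S1 = real s * (real n - real s + 1) - real i * (real k - real i)"
    and "S2 = real s * (real n - real s + 1)
              - (real s + real t - real i) * (real k + real i - real s - real t)"
    and "T1 = real i * (real n - real k - real s + real i + 1)
              + (real s - real i) * (real k - real i + 1)"
    and "T2 = (real s + real t - real i) * (real n - real k - real i + real t + 1)
              + (real i - real t) * (real k - real s - real t + real i + 1)"
  shows "(real k - real i + 1) * (real k + real i + 1 - real s - real t) * S1 * S2
           / ((real n - real s + 1)\<^sup>2 * T1 * T2)
         > real ((n - s) choose (k - i)) * real ((n - s) choose (k + i - s - t))
           / (real ((n - s) choose (k - i + 1)) * real ((n - s) choose (k + i + 1 - s - t)))"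
proof -
  define j where "j = s + t - i"
  define M where "M = real n - real s + 1"
  have i: "t + 1 \<le> i" "i \<le> k" "2 * i \<le> s + t" "s + t \<le> k + i" "t + 3 \<le> s"
    using assms(8,10,11) by auto
  have s: "s + t = i + j" and j: "i \<le> j" "j \<le> k"
    using i by (auto simp: j_def)
  have s_real: "real s = real i + real j - real t"
    using s by linarith
  have ij_real: "real t + 1 \<le> real i" "real i \<le> real j" "real j \<le> real k"
    using i j by auto
  \<comment> \<open>This product is exactly
    \<open>(t + 1) * (k - t + 1) - (4 * k - 3 * t + 1)\<close>, so it yields a lower bound on
    \<open>n\<close> that is linear.\<close>
  have "0 \<le> (real t - 3) * (real k - real t)"
    using assms(6) i by simp
  then have n: "4 * real k - 3 * real t + 1 \<le> real n"
    using assms(7) by (simp add: algebra_simps)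
  \<comment> \<open>These say \<open>k - i < n - s\<close> and \<open>k - j < n - s\<close>, as
    \<open>binomial_ratio\<close> requires.\<close>
  have a: "0 < M - 1 - (real k - real i)" and b: "0 < M - 1 - (real k - real j)"
    using n s_real ij_real unfolding M_def by linarith+
  have "s \<le> n"
    using a i(2) by (simp add: M_def)
  have "(real t + 1) * (real j + (real k - real j) - real t + 1) - (real i + real j - real t - 1) \<le> M"
    using assms(7) by (simp add: M_def s_real)
  \<comment> \<open>If \<open>i = t + 1\<close>, then \<open>s = j + 1\<close>, so
    \<open>t + 3 \<le> s\<close> forces \<open>j > i\<close>. For \<open>t = 3\<close>, the value
    \<open>j = i + 1\<close> would give the excluded triple \<open>(6, 4, 3)\<close>.\<close>
  moreover have "t + 2 \<le> i \<or> i = t + 1 \<and> 4 \<le> t \<and> i + 1 \<le> j \<or> i = t + 1 \<and> t = 3 \<and> i + 2 \<le> j"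
    using assms(6,12) i s by auto
  then have "real t + 2 \<le> real i \<or> real i = real t + 1 \<and> 4 \<le> real t \<and> real i + 1 \<le> real j
      \<or> real i = real t + 1 \<and> real t = 3 \<and> real i + 2 \<le> real j"
    by linarith
  ultimately have gap: "0 < gap (real t) (real i) (real j) (real k - real j) M"
    using assms(6) i j by (intro gap_pos) auto
  have S1: "S1 = real s * M - real i * (real k - real i)"
    and S2: "S2 = real s * M - real j * (real k - real j)"
    using assms(13,14) by (simp_all add: M_def s_real algebra_simps)
  have T1: "T1 = real i * (M - (real k - real i)) + (real s - real i) * (real k - real i + 1)"
    and T2: "T2 = real j * (M - (real k - real j)) + (real s - real j) * (real k - real j + 1)"
    using assms(15,16) by (simp_all add: M_def s_real algebra_simps)
  have "0 < T1"
    unfolding T1 using a i j s_real by (intro add_nonneg_pos mult_nonneg_nonneg mult_pos_pos) auto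
  have "0 < T2"
    unfolding T2 using b i j s_real by (intro add_nonneg_pos mult_nonneg_nonneg mult_pos_pos) auto
  have "0 < M" using a i by simp
  \<comment> \<open>The binomial quotient will be \<open>c / Y\<close> and the other side is
    \<open>c * (S1 * S2) / X\<close>, so the claim reduces to \<open>X < Y * (S1 * S2)\<close>,
    which is \<open>gap\<close> being positive.\<close>
  define Y where "Y = (M - 1 - (real k - real i)) * (M - 1 - (real k - real j))"
  define X where "X = M\<^sup>2 * T1 * T2"
  define c where "c = (real k - real i + 1) * (real k - real j + 1)"
  have pos: "0 < X" "0 < Y" "0 < c"
    using \<open>0 < M\<close> \<open>0 < T1\<close> \<open>0 < T2\<close> a b i j by (simp_all add: X_def Y_def c_def)
  have "X < Y * (S1 * S2)"
    using gap unfolding X_def Y_def S1 S2 T1 T2 gap_def Let_def s_real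
    by (simp add: power2_eq_square mult_ac)
  then have less: "c / Y < c * (S1 * S2) / X"
    using pos by (simp add: field_simps)
  have "real ((n - s) choose (k - i)) / real ((n - s) choose Suc (k - i))
      = (real k - real i + 1) / (M - 1 - (real k - real i))"
    using binomial_ratio[of "k - i" "n - s"] a i \<open>s \<le> n\<close> by (simp add: M_def of_nat_diff)
  moreover have "real ((n - s) choose (k - j)) / real ((n - s) choose Suc (k - j))
      = (real k - real j + 1) / (M - 1 - (real k - real j))"
    using binomial_ratio[of "k - j" "n - s"] b j \<open>s \<le> n\<close> by (simp add: M_def of_nat_diff)
  ultimately have "real ((n - s) choose (k - i)) * real ((n - s) choose (k - j))
      / (real ((n - s) choose Suc (k - i)) * real ((n - s) choose Suc (k - j))) = c / Y"
    unfolding c_def Y_def times_divide_times_eq[symmetric] by simp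
  \<comment> \<open>The second equation relies on \<open>j \<le> k\<close>, because subtraction on
    naturals truncates.\<close>
  moreover have "k + i - s - t = k - j" "k + i + 1 - s - t = Suc (k - j)" "k - i + 1 = Suc (k - i)"
    using s j by auto
  moreover have "real k + real i + 1 - real s - real t = real k - real j + 1"
    using s_real by simp
  ultimately show ?thesis
    using less unfolding c_def X_def M_def by (simp only: mult.assoc)
qed

end
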